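(* Let $n, m \ge 1$ be integers and let $P(\lambda) = I\lambda^m + A_{m-1}\lambda^{m-1} + \cdots + A_1\lambda + A_0$ be an $n\times n$ monic matrix polynomial, where $A_l \in M_n(\mathbb{C})$ for $0 \le l \le m-1$ and $I$ is the $n\times n$ identity matrix. If $\lambda_1,\ldots,\lambda_{mn}$ are the eigenvalues of $P(\lambda)$, counted with algebraic multiplicity, then $$\prod_{k=1}^{mn}\lambda_k = (-1)^{mn}\det(A_0).$$
   Context: $M_n(\mathbb{C})$ is the set of $n\times n$ complex matrices. When the leading coefficient of an $n\times n$ matrix polynomial $P(\lambda)$ of degree $m$ is nonsingular (in particular when it is $I$), the eigenvalues of $P(\lambda)$ are the complex numbers $\lambda_0$ with $\det P(\lambda_0)=0$; the algebraic multiplicity of an eigenvalue is its multiplicity as a root of the scalar polynomial $\det P(\lambda)$, and there are exactly $mn$ eigenvalues counted with algebraic multiplicity. *)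

theory Defs
  imports
    "HOL-Computational_Algebra.Polynomial"
    "Jordan_Normal_Form.Determinant"
begin

text \<open>
  A matrix polynomial is represented as a matrix with polynomial entries, so that its determinant
  is the scalar polynomial whose roots give the eigenvalues.  The coefficients are
  \<open>A 0, \<dots>, A m\<close>; the values \<open>A l\<close> for \<open>l > m\<close> play no role.
\<close>

definition matrix_poly :: "nat \<Rightarrow> nat \<Rightarrow> (nat \<Rightarrow> complex mat) \<Rightarrow> complex poly mat" where
  "matrix_poly n m A = mat n n (\<lambda>(i, j). \<Sum>l\<le>m. monom (A l $$ (i, j)) l)"

definition matrix_poly_eval :: "complex poly mat \<Rightarrow> complex \<Rightarrow> complex mat" where
  "matrix_poly_eval P z = map_mat (\<lambda>p. poly p z) P"

lemma matrix_poly_eval_matrix_poly: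
  "matrix_poly_eval (matrix_poly n m A) z = mat n n (\<lambda>(i, j). \<Sum>l\<le>m. A l $$ (i, j) * z ^ l)"
  by (rule eq_matI) (auto simp: matrix_poly_eval_def matrix_poly_def poly_sum poly_monom)

text \<open>
  The next two notions are meant for matrix polynomials with nonsingular leading coefficient.  In
  particular \<open>det P \<noteq> 0\<close> then, which \<open>order\<close> needs in order to be the root multiplicity.
\<close>

definition mp_eigenvalue :: "complex poly mat \<Rightarrow> complex \<Rightarrow> bool" where
  "mp_eigenvalue P z \<longleftrightarrow> det (matrix_poly_eval P z) = 0"

definition mp_alg_multiplicity :: "complex poly mat \<Rightarrow> complex \<Rightarrow> nat" where
  "mp_alg_multiplicity P z = order z (det P)"

definition lists_mp_eigenvalues ::
  "complex poly mat \<Rightarrow> nat \<Rightarrow> (nat \<Rightarrow> complex) \<Rightarrow> bool" where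
  "lists_mp_eigenvalues P N ev \<longleftrightarrow>
     (\<forall>k\<in>{1..N}. mp_eigenvalue P (ev k)) \<and>
     (\<forall>z. mp_eigenvalue P z \<longrightarrow> card {k \<in> {1..N}. ev k = z} = mp_alg_multiplicity P z)"

end

theory Submission
  imports
    Defs
    "HOL-Computational_Algebra.Fundamental_Theorem_Algebra"
begin

text \<open>
  The coefficient of degree \<open>m * n\<close> of \<open>det P\<close> is the determinant of the leading coefficient of \<open>P\<close>,
  so \<open>det P\<close> is monic and hence the product of the factors \<open>\<lambda> - ev k\<close>.  Evaluate at \<open>0\<close>.
\<close>

lemma degree_prod_le_card_mult:
  fixes f :: "'b \<Rightarrow> 'a::comm_semiring_1 poly"
  assumes "\<And>i. i \<in> S \<Longrightarrow> degree (f i) \<le> d"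
  shows "degree (prod f S) \<le> card S * d"
proof (cases "finite S")
  case True
  then have "degree (prod f S) \<le> sum (degree \<circ> f) S"
    by (rule degree_prod_sum_le)
  also have "\<dots> \<le> card S * d"
    using assms sum_bounded_above[of S "degree \<circ> f" d] by simp
  finally show ?thesis .
qed simp

text \<open>In the convolution sum only \<open>i = a\<close> survives: for \<open>i > a\<close> the
  factor from \<open>p\<close> vanishes, and for \<open>i < a\<close> the index
  \<open>a + b - i\<close> exceeds \<open>b\<close>. Since \<open>a\<close> and \<open>b\<close> are
  mere bounds, the coefficients there may be zero.\<close>

lemma coeff_mult_degree_bounds:
  fixes p q :: "'a::comm_semiring_1 poly"
  assumes "degree p \<le> a" and "degree q \<le> b"
  shows "coeff (p * q) (a + b) = coeff p a * coeff q b"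
proof -
  have "coeff p i * coeff q (a + b - i) = 0" if "i \<le> a + b" "i \<noteq> a" for i
    using that assms by (cases "i < a") (simp_all add: coeff_eq_0)
  then have "(\<Sum>i\<le>a + b. coeff p i * coeff q (a + b - i)) =
      (\<Sum>i\<in>{a}. coeff p i * coeff q (a + b - i))"
    by (intro sum.mono_neutral_right) auto
  then show ?thesis
    by (simp add: coeff_mult)
qed

lemma coeff_prod_degree_bound:
  fixes f :: "'b \<Rightarrow> 'a::comm_semiring_1 poly"
  assumes "finite S" and "\<And>i. i \<in> S \<Longrightarrow> degree (f i) \<le> d"
  shows "coeff (prod f S) (card S * d) = (\<Prod>i\<in>S. coeff (f i) d)"
  using assms
proof (induction S rule: finite_induct)
  case (insert x S)
  have "coeff (f x * prod f S) (d + card S * d) = coeff (f x) d * coeff (prod f S) (card S * d)"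
    using insert.prems by (intro coeff_mult_degree_bounds degree_prod_le_card_mult) auto
  with insert show ?case
    by simp
qed simp

context
  fixes P :: "'a::comm_ring_1 poly mat" and n d :: nat
  assumes P: "P \<in> carrier_mat n n"
    and degree_entry: "\<And>i j. i < n \<Longrightarrow> j < n \<Longrightarrow> degree (P $$ (i, j)) \<le> d"
begin

lemma degree_entry_permutes:
  assumes "\<pi> permutes {0..<n}" and "i \<in> {0..<n}"
  shows "degree (P $$ (i, \<pi> i)) \<le> d"
  using assms permutes_in_image[OF assms(1), of i] by (auto intro: degree_entry)

text \<open>Makes the sign in the Leibniz formula a constant polynomial, so that multiplying by it
  is a scalar multiplication and acts coefficientwise.\<close>

lemma signof_poly: "(of_int (sign \<pi>) :: 'a poly) = [:of_int (sign \<pi>):]"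
  by (simp add: of_int_poly)

lemma degree_det_le: "degree (det P) \<le> n * d"
  unfolding det_def'[OF P]
proof (intro degree_sum_le)
  show "finite {\<pi>. \<pi> permutes {0..<n}}"
    by (simp add: finite_permutations)
  fix \<pi> assume "\<pi> \<in> {\<pi>. \<pi> permutes {0..<n}}"
  then have "degree (\<Prod>i = 0..<n. P $$ (i, \<pi> i)) \<le> n * d"
    using degree_prod_le_card_mult[of "{0..<n}" "\<lambda>i. P $$ (i, \<pi> i)" d] degree_entry_permutes
    by auto
  then show "degree (signof \<pi> * (\<Prod>i = 0..<n. P $$ (i, \<pi> i))) \<le> n * d"
    by (simp add: signof_poly order.trans[OF degree_smult_le])
qed

text \<open>In each Leibniz term the coefficient of degree \<open>n * d\<close> is the product of
  the degree \<open>d\<close> coefficients of its \<open>n\<close> entries, so the sum is the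
  Leibniz expansion for the matrix of these coefficients.\<close>

lemma coeff_det_top: "coeff (det P) (n * d) = det (map_mat (\<lambda>p. coeff p d) P)"
proof -
  have "coeff (signof \<pi> * (\<Prod>i = 0..<n. P $$ (i, \<pi> i))) (n * d) =
      signof \<pi> * (\<Prod>i = 0..<n. map_mat (\<lambda>p. coeff p d) P $$ (i, \<pi> i))"
    if "\<pi> permutes {0..<n}" for \<pi>
  proof -
    have "coeff (\<Prod>i = 0..<n. P $$ (i, \<pi> i)) (n * d) = (\<Prod>i = 0..<n. coeff (P $$ (i, \<pi> i)) d)"
      using coeff_prod_degree_bound[of "{0..<n}" "\<lambda>i. P $$ (i, \<pi> i)" d]
        degree_entry_permutes[OF that] by simp
    also have "\<dots> = (\<Prod>i = 0..<n. map_mat (\<lambda>p. coeff p d) P $$ (i, \<pi> i))"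
      using P permutes_in_image[OF that] by (intro prod.cong) auto
    finally show ?thesis
      by (simp add: signof_poly)
  qed
  moreover have "map_mat (\<lambda>p. coeff p d) P \<in> carrier_mat n n"
    using P by simp
  ultimately show ?thesis
    unfolding det_def'[OF P] coeff_sum by (subst det_def') (auto intro: sum.cong)
qed

end

text \<open>Evaluation at \<open>z\<close> is a ring homomorphism, and determinants commute with
  those.\<close>

lemma poly_det: "poly (det P) z = det (map_mat (\<lambda>p. poly p z) P)"
  for z :: "'a::comm_ring_1"
proof -
  interpret comm_ring_hom "\<lambda>p. poly p z"
    by unfold_locales auto
  show ?thesis
    by simp
qed

text \<open>A monic complex polynomial is the product of its linear factors. Each root
  \<open>z\<close> occurs \<open>order z p\<close> times there, exactly as often as
  \<open>ev\<close> takes the value \<open>z\<close>.\<close>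

lemma poly_0_monic_eq_prod:
  fixes p :: "complex poly" and ev :: "'b \<Rightarrow> complex"
  assumes "lead_coeff p = 1" and "finite K"
    and "\<And>k. k \<in> K \<Longrightarrow> poly p (ev k) = 0"
    and "\<And>z. poly p z = 0 \<Longrightarrow> card {k \<in> K. ev k = z} = order z p"
  shows "poly p 0 = (\<Prod>k\<in>K. - ev k)"
proof -
  have "p \<noteq> 0"
    using assms(1) by auto
  have "poly p 0 = poly (\<Prod>z | poly p z = 0. [:-z, 1:] ^ order z p) 0"
    using complex_poly_decompose[of p] assms(1) by simp
  also have "\<dots> = (\<Prod>z | poly p z = 0. (- z) ^ card {k \<in> K. ev k = z})"
    by (simp add: poly_prod assms(4))
  also have "\<dots> = (\<Prod>z | poly p z = 0. \<Prod>k \<in> {k \<in> K. ev k = z}. - ev k)"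
    by simp
  \<comment> \<open>The fibres of \<open>ev\<close> over the finite root set partition
    \<open>K\<close>, because every \<open>ev k\<close> is a root.\<close>
  also have "\<dots> = (\<Prod>k\<in>K. - ev k)"
    using assms(2,3) poly_roots_finite[OF \<open>p \<noteq> 0\<close>] by (intro prod.group) auto
  finally show ?thesis .
qed

theorem theorem3p3:
  fixes n m :: nat
    and A :: "nat \<Rightarrow> complex mat"
    and ev :: "nat \<Rightarrow> complex"
  assumes "n \<ge> 1" and "m \<ge> 1"
    and "\<And>l. l < m \<Longrightarrow> A l \<in> carrier_mat n n"
    and "A m = 1\<^sub>m n"
    and "lists_mp_eigenvalues (matrix_poly n m A) (m * n) ev"
  shows "(\<Prod>k=1..m * n. ev k) = (-1) ^ (m * n) * det (A 0)"
proof -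
  define P where "P = matrix_poly n m A"
  have P: "P \<in> carrier_mat n n"
    by (simp add: P_def matrix_poly_def)
  have deg: "degree (P $$ (i, j)) \<le> m" if "i < n" "j < n" for i j
    using that by (auto simp: P_def matrix_poly_def intro!: degree_sum_le
        order.trans[OF degree_monom_le])
  have "map_mat (\<lambda>p. coeff p m) P = 1\<^sub>m n"
    by (rule eq_matI) (auto simp: P_def matrix_poly_def coeff_sum assms(4))
  then have top: "coeff (det P) (n * m) = 1"
    using coeff_det_top[OF P deg] by simp
  \<comment> \<open>The nonzero coefficient just found shows that the upper bound on the degree is
    attained.\<close>
  then have "degree (det P) = n * m"
    using degree_det_le[OF P deg] le_degree[of "det P" "n * m"] by simp
  with top have "lead_coeff (det P) = 1"
    by simp
  moreover have "mp_eigenvalue P z \<longleftrightarrow> poly (det P) z = 0" for z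
    by (simp add: mp_eigenvalue_def matrix_poly_eval_def poly_det)
  ultimately have "poly (det P) 0 = (\<Prod>k=1..m * n. - ev k)"
    using assms(5) by (intro poly_0_monic_eq_prod)
      (auto simp: lists_mp_eigenvalues_def mp_alg_multiplicity_def P_def)
  also have "\<dots> = (-1) ^ (m * n) * (\<Prod>k=1..m * n. ev k)"
    by (simp add: prod_uminus)
  \<comment> \<open>The sign changes sides because its square is 1.\<close>
  finally have "(\<Prod>k=1..m * n. ev k) = (-1) ^ (m * n) * poly (det P) 0"
    by (simp flip: power_add mult.assoc)
  \<comment> \<open>At 0 only the term \<open>l = 0\<close> remains; \<open>m \<ge> 1\<close> puts
    \<open>A 0\<close> among the coefficients assumed to be of size \<open>n\<close>.\<close>
  also have "map_mat (\<lambda>p. poly p 0) P = A 0"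
    using assms(2) assms(3)[of 0]
    by (intro eq_matI) (auto simp: P_def matrix_poly_def poly_sum poly_monom power_0_left
        if_distrib cong: if_cong)
  then have "poly (det P) 0 = det (A 0)"
    by (simp add: poly_det)
  finally show ?thesis .
qed

end
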